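(* Let $X$ be an infinite-dimensional real Hilbert space and let $C$ be an unbounded closed convex subset of $X$. If, in addition, $C$ is locally compact, then $C$ does not have the strong separation property.
   Context: The closed convex set $C$ is called locally compact if there exist $c_0\in C$ and $r>0$ such that $\overline{B(c_0;r)}\cap C$ is (norm) compact, where $\overline{B(c_0;r)}$ is the closed ball of radius $r$ around $c_0$. Convex sets $C,D\subset X$ are strongly separated if there exists $x^*\in X^*\setminus\{0\}$ with $\sup_{c\in C}\langle x^*,c\rangle<\inf_{d\in D}\langle x^*,d\rangle$. A convex set $C$ has the strong separation property if it is strongly separated from every nonempty closed convex subset $D$ of $X$ disjoint from $C$. *)

theory Defs
  imports "HOL-Analysis.Analysis"
begin

(* Compactness of a single ball trace suffices here; this is not the library's "locally compact". *)
definition locally_compact_convex :: "'a::real_normed_vector set \<Rightarrow> bool" where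
  "locally_compact_convex C \<longleftrightarrow> (\<exists>c0\<in>C. \<exists>r>0. compact (cball c0 r \<inter> C))"

(* The dual space is the type of bounded linear functionals. The bounds are taken in the extended
   reals, since a functional may be unbounded on C or D. *)
definition strongly_separated :: "'a::real_normed_vector set \<Rightarrow> 'a set \<Rightarrow> bool" where
  "strongly_separated C D \<longleftrightarrow>
     (\<exists>f :: 'a \<Rightarrow>\<^sub>L real. f \<noteq> 0 \<and>
        (SUP c\<in>C. ereal (blinfun_apply f c)) < (INF d\<in>D. ereal (blinfun_apply f d)))"

definition strong_separation_property :: "'a::real_normed_vector set \<Rightarrow> bool" where
  "strong_separation_property C \<longleftrightarrow>
     (\<forall>D. D \<noteq> {} \<and> closed D \<and> convex D \<and> C \<inter> D = {} \<longrightarrow> strongly_separated C D)"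

end

theory Submission
  imports Defs
begin

text \<open>Local compactness makes the unbounded set \<open>C\<close> contain a ray \<open>c0 + t u\<close> (\<open>t \<ge> 0\<close>), and makes
  the cone generated by \<open>C - c0\<close> a countable union of compact sets. In infinite dimension such
  a union, even after adding the line spanned by \<open>u\<close>, is not the whole space by Baire's theorem.
  If \<open>w\<close> lies outside, the hyperbola-shaped set \<open>D = {c0 + s u + t w | s, t \<ge> 0, s t \<ge> 1}\<close> is disjoint
  from \<open>C\<close>, but its points \<open>c0 + s u + w / s\<close> approach the ray as \<open>s\<close> tends to infinity.\<close>

text \<open>Riesz-type argument: a finite net at scale \<open>r\<close> for the ball, recentred at
  0, spans a proper subspace. A vector of length \<open>r\<close> orthogonal to that subspace is at
  distance at least \<open>r\<close> from every net point, by Pythagoras.\<close>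

lemma infinite_dim_imp_not_compact_cball:
  fixes x :: "'a::real_inner"
  assumes infinite_dim: "\<not> (\<exists>B :: 'a set. finite B \<and> span B = UNIV)" and "r > 0"
  shows "\<not> compact (cball x r)"
proof
  assume "compact (cball x r)"
  then have "compact ((\<lambda>y. y - x) ` cball x r)"
    by (intro compact_continuous_image continuous_intros)
  then obtain F where F: "finite F" "(\<lambda>y. y - x) ` cball x r \<subseteq> (\<Union>b\<in>F. ball b r)"
    using seq_compact_imp_totally_bounded[of "(\<lambda>y. y - x) ` cball x r"] \<open>r > 0\<close>
    by (auto simp: compact_eq_seq_compact_metric)
  obtain B where B: "finite B" "span B = span F" "pairwise orthogonal B"
    using basis_orthogonal[OF F(1)] by blast
  obtain a where a: "a \<notin> span B"
    using infinite_dim B(1) by blast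
  \<comment> \<open>\<open>z\<close> is \<open>a\<close> minus its orthogonal projection onto
    \<open>span B\<close>. The set \<open>B\<close> may contain 0; that term vanishes because
    division by zero gives 0.\<close>
  define z where "z = a - (\<Sum>b\<in>B. (b \<bullet> a / (b \<bullet> b)) *\<^sub>R b)"
  have "(\<Sum>b\<in>B. (b \<bullet> a / (b \<bullet> b)) *\<^sub>R b) \<in> span B"
    by (intro span_sum span_scale span_base)
  then have "z \<noteq> 0"
    using a by (auto simp: z_def)
  have "orthogonal z b" if "b \<in> B" for b
  proof -
    have "(\<Sum>c\<in>B. (c \<bullet> a / (c \<bullet> c)) * (c \<bullet> b)) = (\<Sum>c\<in>B. if c = b then b \<bullet> a else 0)"
      using B(3) that by (intro sum.cong) (auto simp: pairwise_def orthogonal_def)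
    then show ?thesis
      using B(1) that
      by (simp add: z_def orthogonal_def inner_diff_left inner_sum_left inner_commute[of a b])
  qed
  then have orth: "orthogonal z b" if "b \<in> F" for b
    using orthogonal_to_span[of b B z] that B(2) span_base by blast
  define v where "v = (r / norm z) *\<^sub>R z"
  have v: "norm v = r"
    using \<open>z \<noteq> 0\<close> \<open>r > 0\<close> by (simp add: v_def)
  then have "v \<in> (\<lambda>y. y - x) ` cball x r"
    by (intro image_eqI[of _ _ "x + v"]) (auto simp: dist_norm)
  then obtain b where b: "b \<in> F" "dist b v < r"
    using F(2) by auto
  have "(norm (v - b))\<^sup>2 = (norm v)\<^sup>2 + (norm b)\<^sup>2"
    using orth[OF b(1)] norm_add_Pythagorean[of v "- b"] by (simp add: v_def orthogonal_def)
  then have "r\<^sup>2 \<le> (norm (v - b))\<^sup>2"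
    using v by simp
  then have "r \<le> norm (v - b)"
    by (rule power2_le_imp_le) simp
  then show False
    using b(2) by (simp add: dist_norm norm_minus_commute)
qed

text \<open>A compact set with an interior point would contain a compact closed ball. Hence each
  \<open>K n\<close> is closed with empty interior, and Baire's theorem in the complete space
  applies.\<close>

lemma Union_compact_neq_UNIV:
  fixes K :: "nat \<Rightarrow> 'a::{real_inner, complete_space} set"
  assumes infinite_dim: "\<not> (\<exists>B :: 'a set. finite B \<and> span B = UNIV)"
    and K: "\<And>n. compact (K n)"
  shows "(\<Union>n. K n) \<noteq> UNIV"
proof -
  have "interior (K n) = {}" for n
  proof (rule ccontr)
    assume "interior (K n) \<noteq> {}"
    then obtain x e where "e > 0" "cball x e \<subseteq> K n"
      by (auto simp: mem_interior_cball)
    then have "compact (cball x e)"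
      using compact_Int_closed[OF K[of n] closed_cball[of x e]] by (simp add: Int_absorb1)
    with infinite_dim_imp_not_compact_cball[OF infinite_dim \<open>e > 0\<close>] show False
      by blast
  qed
  then have "euclidean interior_of (\<Union>(range K)) = {}"
    using K by (intro Baire_category_alt)
      (auto simp: completely_metrizable_space_euclidean compact_imp_closed)
  then show ?thesis
    by auto
qed

text \<open>Take the unit directions from \<open>c0\<close> to points of \<open>C\<close> that run
  off to infinity. Compactness at distance \<open>r\<close> makes a subsequence of them converge,
  and closedness of \<open>C\<close> places the limiting ray inside \<open>C\<close>.\<close>

lemma closed_convex_contains_ray:
  fixes C :: "'a::real_normed_vector set"
  assumes "closed C" "convex C" "\<not> bounded C" "c0 \<in> C" "r > 0" "compact (cball c0 r \<inter> C)"
  obtains u where "norm u = 1" "\<And>t. t \<ge> 0 \<Longrightarrow> c0 + t *\<^sub>R u \<in> C"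
proof -
  \<comment> \<open>The extra \<open>r\<close> makes every segment from \<open>c0\<close> to
    \<open>x n\<close> longer than \<open>r\<close>, even for \<open>n = 0\<close>, so each one
    passes through the compact trace.\<close>
  have "\<exists>x\<in>C. norm (x - c0) > real n + r" for n
  proof (rule ccontr)
    assume "\<not> ?thesis"
    then have "C \<subseteq> cball c0 (real n + r)"
      by (auto simp: dist_norm norm_minus_commute not_less)
    with \<open>\<not> bounded C\<close> show False
      using bounded_cball bounded_subset by blast
  qed
  then obtain x where x: "\<And>n. x n \<in> C" "\<And>n. norm (x n - c0) > real n + r"
    by metis
  define v where "v n = (1 / norm (x n - c0)) *\<^sub>R (x n - c0)" for n
  have pos: "norm (x n - c0) > 0" for n
    using x(2)[of n] \<open>r > 0\<close> by linarith
  have norm_v: "norm (v n) = 1" for n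
    using pos[of n] by (simp add: v_def)
  have vC: "c0 + t *\<^sub>R v n \<in> C" if "0 \<le> t" "t \<le> norm (x n - c0)" for t n
  proof -
    define a where "a = t / norm (x n - c0)"
    have "0 \<le> a" "a \<le> 1"
      using that pos[of n] by (auto simp: a_def)
    then have "(1 - a) *\<^sub>R c0 + a *\<^sub>R x n \<in> C"
      using \<open>convex C\<close> \<open>c0 \<in> C\<close> x(1) by (simp add: convex_alt)
    moreover have "(1 - a) *\<^sub>R c0 + a *\<^sub>R x n = c0 + t *\<^sub>R v n"
      by (simp add: a_def v_def algebra_simps)
    ultimately show ?thesis by simp
  qed
  have "c0 + r *\<^sub>R v n \<in> cball c0 r \<inter> C" for n
    using vC[of r n] x(2)[of n] \<open>r > 0\<close> norm_v[of n] by (auto simp: dist_norm)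
  then obtain l \<sigma> where l: "strict_mono (\<sigma> :: nat \<Rightarrow> nat)"
      "((\<lambda>n. c0 + r *\<^sub>R v n) \<circ> \<sigma>) \<longlonglongrightarrow> l"
    using \<open>compact (cball c0 r \<inter> C)\<close> unfolding compact_def by metis
  define u where "u = (1 / r) *\<^sub>R (l - c0)"
  have "(\<lambda>n. (1 / r) *\<^sub>R (((\<lambda>n. c0 + r *\<^sub>R v n) \<circ> \<sigma>) n - c0)) \<longlonglongrightarrow> u"
    unfolding u_def by (intro tendsto_intros l)
  then have lim: "(\<lambda>n. v (\<sigma> n)) \<longlonglongrightarrow> u"
    using \<open>r > 0\<close> by simp
  show thesis
  proof
    have "(\<lambda>n. norm (v (\<sigma> n))) \<longlonglongrightarrow> norm u"
      by (intro tendsto_intros lim)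
    then show "norm u = 1"
      by (simp add: norm_v LIMSEQ_const_iff)
  next
    fix t :: real assume "t \<ge> 0"
    \<comment> \<open>For fixed \<open>t\<close>, all late segments have length at least
      \<open>t\<close>, because \<open>\<sigma> n\<close> is at least \<open>n\<close>.\<close>
    have "eventually (\<lambda>n. c0 + t *\<^sub>R v (\<sigma> n) \<in> C) sequentially"
      using eventually_ge_at_top[of "nat \<lceil>t\<rceil>"]
    proof eventually_elim
      case (elim n)
      have "t \<le> real n"
        using elim by linarith
      also have "\<dots> \<le> real (\<sigma> n)"
        using seq_suble[OF l(1)] by simp
      also have "\<dots> \<le> norm (x (\<sigma> n) - c0)"
        using x(2)[of "\<sigma> n"] \<open>r > 0\<close> by linarith
      finally show ?case
        by (intro vC \<open>t \<ge> 0\<close>)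
    qed
    moreover have "(\<lambda>n. c0 + t *\<^sub>R v (\<sigma> n)) \<longlonglongrightarrow> c0 + t *\<^sub>R u"
      by (intro tendsto_intros lim)
    ultimately show "c0 + t *\<^sub>R u \<in> C"
      by (intro Lim_in_closed_set[OF \<open>closed C\<close>]) auto
  qed
qed

lemma exists_orthogonal_outside_cone:
  fixes C :: "'a::{real_inner, complete_space} set"
  assumes infinite_dim: "\<not> (\<exists>B :: 'a set. finite B \<and> span B = UNIV)"
    and "convex C" "c0 \<in> C" "r > 0" "compact (cball c0 r \<inter> C)" "norm u = 1"
  obtains w where "w \<noteq> 0" "u \<bullet> w = 0" "\<And>s t. t > 0 \<Longrightarrow> c0 + s *\<^sub>R u + t *\<^sub>R w \<notin> C"
proof -
  \<comment> \<open>The images of the boxes \<open>P n\<close> exhaust all sums of a real multiple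
    of \<open>p - c0\<close>, with \<open>p\<close> in the compact trace, and a real multiple of
    \<open>u\<close>.\<close>
  define g where "g = (\<lambda>(p, a :: real, b :: real). a *\<^sub>R (p - c0) + b *\<^sub>R u)"
  define P where "P n = (cball c0 r \<inter> C) \<times> {- real n..real n} \<times> {- real n..real n}" for n
  have "compact (g ` P n)" for n
    unfolding g_def P_def split_beta using assms
    by (intro compact_continuous_image continuous_intros compact_Times) auto
  then have "(\<Union>n. g ` P n) \<noteq> UNIV"
    by (rule Union_compact_neq_UNIV[OF infinite_dim])
  then obtain y where y: "\<And>n. y \<notin> g ` P n"
    by blast
  have y_ball: "y \<noteq> a *\<^sub>R (p - c0) + b *\<^sub>R u" if "p \<in> C" "p \<in> cball c0 r" for p a b
  proof
    assume eq: "y = a *\<^sub>R (p - c0) + b *\<^sub>R u"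
    define n where "n = nat \<lceil>max \<bar>a\<bar> \<bar>b\<bar>\<rceil>"
    have "\<bar>a\<bar> \<le> real n" "\<bar>b\<bar> \<le> real n"
      unfolding n_def by linarith+
    then have "(p, a, b) \<in> P n"
      using that by (auto simp: P_def)
    moreover have "y = g (p, a, b)"
      by (simp add: g_def eq)
    ultimately show False
      using y[of n] by blast
  qed
  have y_cone: "y \<noteq> a *\<^sub>R (c - c0) + b *\<^sub>R u" if "c \<in> C" for c a b
  proof -
    \<comment> \<open>Shrinking \<open>c\<close> towards \<open>c0\<close> by the factor
      \<open>m\<close> reaches the ball of radius \<open>r\<close>. Since \<open>m\<close> is at
      least 1, convexity keeps the point in \<open>C\<close>, and the factor is absorbed into the
      coefficient \<open>a\<close>.\<close>
    define m where "m = max 1 (norm (c - c0) / r)"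
    define p where "p = c0 + (1 / m) *\<^sub>R (c - c0)"
    have m: "m \<ge> 1" "norm (c - c0) / r \<le> m"
      by (auto simp: m_def)
    have "(1 - 1 / m) *\<^sub>R c0 + (1 / m) *\<^sub>R c \<in> C"
      using \<open>convex C\<close> \<open>c0 \<in> C\<close> that m by (simp add: convex_alt)
    then have "p \<in> C"
      by (simp add: p_def algebra_simps)
    moreover have "p \<in> cball c0 r"
    proof -
      have "dist c0 p = norm (c - c0) / m"
        using m by (simp add: p_def dist_norm)
      then show ?thesis
        using m \<open>r > 0\<close> by (simp add: pos_divide_le_eq mult.commute)
    qed
    moreover have "a *\<^sub>R (c - c0) = (a * m) *\<^sub>R (p - c0)"
      using m by (simp add: p_def)
    ultimately show ?thesis
      using y_ball by metis
  qed
  \<comment> \<open>Removing the \<open>u\<close>-component of \<open>y\<close> is harmless, since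
    the set that \<open>y\<close> avoids is invariant under translation along
    \<open>u\<close>.\<close>
  define w where "w = y - (u \<bullet> y) *\<^sub>R u"
  show thesis
  proof
    show "w \<noteq> 0"
      using y_cone[OF \<open>c0 \<in> C\<close>, of 0 "u \<bullet> y"] by (simp add: w_def)
    show "u \<bullet> w = 0"
      using \<open>norm u = 1\<close> by (simp add: w_def inner_diff_right flip: power2_norm_eq_inner)
    fix s t :: real assume "t > 0"
    show "c0 + s *\<^sub>R u + t *\<^sub>R w \<notin> C"
    proof
      assume "c0 + s *\<^sub>R u + t *\<^sub>R w \<in> C"
      \<comment> \<open>The coefficients come from solving the assumed membership for
        \<open>y = w + (u \<bullet> y) *\<^sub>R u\<close>.\<close>
      from y_cone[OF this, of "1 / t" "u \<bullet> y - s / t"] \<open>t > 0\<close> show False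
        by (simp add: w_def algebra_simps)
    qed
  qed
qed

text \<open>Orthogonality lets the coordinates \<open>s\<close> and \<open>t\<close> be recovered by
  continuous functions of the point, so the region is cut out by closed conditions.\<close>

lemma closed_hyperbola_region:
  fixes u w c0 :: "'a::real_inner"
  assumes "norm u = 1" "w \<noteq> 0" "u \<bullet> w = 0"
  shows "closed {c0 + s *\<^sub>R u + t *\<^sub>R w | s t. 0 \<le> s \<and> 0 \<le> t \<and> 1 \<le> s * t}"
proof -
  define S where "S x = u \<bullet> (x - c0)" for x
  define T where "T x = w \<bullet> (x - c0) / (w \<bullet> w)" for x
  have ST: "S (c0 + s *\<^sub>R u + t *\<^sub>R w) = s" "T (c0 + s *\<^sub>R u + t *\<^sub>R w) = t" for s t
    using assms
    by (auto simp: S_def T_def inner_add_right inner_commute[of w u] simp flip: power2_norm_eq_inner)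
  have "{c0 + s *\<^sub>R u + t *\<^sub>R w | s t. 0 \<le> s \<and> 0 \<le> t \<and> 1 \<le> s * t} =
      {x. x = c0 + S x *\<^sub>R u + T x *\<^sub>R w \<and> 0 \<le> S x \<and> 0 \<le> T x \<and> 1 \<le> S x * T x}" (is "?L = ?R")
  proof
    show "?L \<subseteq> ?R"
      by (auto simp: ST)
    show "?R \<subseteq> ?L"
      by blast
  qed
  moreover have "closed ?R"
    unfolding S_def T_def
    using assms by (intro closed_Collect_conj closed_Collect_eq closed_Collect_le continuous_intros) auto
  ultimately show ?thesis
    by simp
qed

lemma convex_hyperbola_region:
  fixes u w c0 :: "'a::real_vector"
  shows "convex {c0 + s *\<^sub>R u + t *\<^sub>R w | s t. 0 \<le> s \<and> 0 \<le> t \<and> 1 \<le> s * t}"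
proof (rule convexI)
  fix x y a b :: _
  let ?D = "{c0 + s *\<^sub>R u + t *\<^sub>R w | s t. 0 \<le> s \<and> 0 \<le> t \<and> (1::real) \<le> s * t}"
  assume "x \<in> ?D" "y \<in> ?D" and ab: "(0::real) \<le> a" "0 \<le> b" "a + b = 1"
  then obtain s t s' t' where x: "x = c0 + s *\<^sub>R u + t *\<^sub>R w" "0 \<le> s" "0 \<le> t" "1 \<le> s * t"
    and y: "y = c0 + s' *\<^sub>R u + t' *\<^sub>R w" "0 \<le> s'" "0 \<le> t'" "1 \<le> s' * t'"
    by blast
  \<comment> \<open>This is the inequality of arithmetic and geometric means for
    \<open>s * t'\<close> and \<open>s' * t\<close>, whose product is at least 1. It controls the
    cross term when the product of the combined coordinates is expanded and compared with
    \<open>(a + b)\<^sup>2 = 1\<close>.\<close>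
  have "2 \<le> s * t' + s' * t"
  proof -
    have "1 \<le> (s * t) * (s' * t')"
      using mult_mono[OF x(4) y(4)] x y by simp
    then have "4 \<le> 4 * ((s * t') * (s' * t))"
      by (simp add: mult_ac)
    also have "\<dots> \<le> (s * t' + s' * t)\<^sup>2"
      using zero_le_power2[of "s * t' - s' * t"] by (simp add: power2_eq_square algebra_simps)
    finally have "2\<^sup>2 \<le> (s * t' + s' * t)\<^sup>2"
      by simp
    then show ?thesis
      by (rule power2_le_imp_le) (use x y in simp)
  qed
  have "1 = a\<^sup>2 * 1 + a * b * 2 + b\<^sup>2 * 1"
    using ab(3) power2_sum[of a b] by simp
  also have "\<dots> \<le> a\<^sup>2 * (s * t) + a * b * (s * t' + s' * t) + b\<^sup>2 * (s' * t')"
    using x y ab \<open>2 \<le> _\<close> by (intro add_mono mult_left_mono) auto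
  also have "\<dots> = (a * s + b * s') * (a * t + b * t')"
    by (simp add: power2_eq_square algebra_simps)
  finally have "1 \<le> (a * s + b * s') * (a * t + b * t')" .
  moreover have "a *\<^sub>R x + b *\<^sub>R y =
      (a + b) *\<^sub>R c0 + (a * s + b * s') *\<^sub>R u + (a * t + b * t') *\<^sub>R w"
    by (simp add: x(1) y(1) algebra_simps)
  ultimately show "a *\<^sub>R x + b *\<^sub>R y \<in> ?D"
    using x y ab by (intro CollectI exI[of _ "a * s + b * s'"] exI[of _ "a * t + b * t'"]) auto
qed

text \<open>Strong separation would keep \<open>f (d n - c n)\<close> above a fixed positive gap,
  while continuity of \<open>f\<close> sends it to 0.\<close>

lemma not_strongly_separated_if_asymptotic:
  assumes c: "\<And>n. c n \<in> C" and d: "\<And>n. d n \<in> D" and lim: "(\<lambda>n. d n - c n) \<longlonglongrightarrow> 0"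
  shows "\<not> strongly_separated C D"
proof
  assume "strongly_separated C D"
  then obtain f :: "'a \<Rightarrow>\<^sub>L real" where
    f: "(SUP c\<in>C. ereal (blinfun_apply f c)) < (INF d\<in>D. ereal (blinfun_apply f d))"
    unfolding strongly_separated_def by blast
  \<comment> \<open>The two bounds may be infinite, so the gap is measured between two reals
    inserted strictly between them.\<close>
  obtain \<alpha> where \<alpha>: "(SUP c\<in>C. ereal (blinfun_apply f c)) < ereal \<alpha>"
      "ereal \<alpha> < (INF d\<in>D. ereal (blinfun_apply f d))"
    using ereal_dense2[OF f] by blast
  obtain \<beta> where \<beta>: "ereal \<alpha> < ereal \<beta>" "ereal \<beta> < (INF d\<in>D. ereal (blinfun_apply f d))"
    using ereal_dense2[OF \<alpha>(2)] by blast
  have "\<beta> - \<alpha> \<le> blinfun_apply f (d n - c n)" for n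
  proof -
    have "ereal (blinfun_apply f (c n)) < ereal \<alpha>"
      using \<alpha>(1) c by (meson SUP_upper le_less_trans)
    moreover have "ereal \<beta> < ereal (blinfun_apply f (d n))"
      using \<beta>(2) d by (meson INF_lower less_le_trans)
    ultimately show ?thesis
      by (simp add: blinfun.diff_right)
  qed
  moreover have "(\<lambda>n. blinfun_apply f (d n - c n)) \<longlonglongrightarrow> blinfun_apply f 0"
    by (intro tendsto_intros lim)
  ultimately have "\<beta> - \<alpha> \<le> blinfun_apply f 0"
    by (intro LIMSEQ_le_const) auto
  with \<beta>(1) show False
    by simp
qed

theorem theorem11:
  fixes C :: "'a::{real_inner, complete_space} set"
  assumes infinite_dim: "\<not> (\<exists>B :: 'a set. finite B \<and> span B = UNIV)"
    and "closed C" and "convex C" and "\<not> bounded C"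
    and "locally_compact_convex C"
  shows "\<not> strong_separation_property C"
proof -
  obtain c0 r where r: "c0 \<in> C" "r > 0" "compact (cball c0 r \<inter> C)"
    using \<open>locally_compact_convex C\<close> unfolding locally_compact_convex_def by blast
  obtain u where u: "norm u = 1" "\<And>t. t \<ge> 0 \<Longrightarrow> c0 + t *\<^sub>R u \<in> C"
    using closed_convex_contains_ray[OF assms(2-4) r] by metis
  obtain w where w: "w \<noteq> 0" "u \<bullet> w = 0" "\<And>s t. t > 0 \<Longrightarrow> c0 + s *\<^sub>R u + t *\<^sub>R w \<notin> C"
    using exists_orthogonal_outside_cone[OF infinite_dim \<open>convex C\<close> r u(1)] by metis
  define D where "D = {c0 + s *\<^sub>R u + t *\<^sub>R w | s t. 0 \<le> s \<and> 0 \<le> t \<and> 1 \<le> s * t}"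
  \<comment> \<open>The parameters \<open>s = Suc n\<close> and \<open>t = 1 / s\<close> put
    \<open>d n\<close> on the boundary curve \<open>s * t = 1\<close>, directly over the point
    \<open>c n\<close> of the ray; \<open>Suc\<close> avoids \<open>s = 0\<close>.\<close>
  define c where "c n = c0 + real (Suc n) *\<^sub>R u" for n
  define d where "d n = c n + inverse (real (Suc n)) *\<^sub>R w" for n
  have d: "d n \<in> D" for n
    unfolding D_def d_def c_def by (intro CollectI exI conjI refl) auto
  have "closed D"
    unfolding D_def by (rule closed_hyperbola_region[OF u(1) w(1,2)])
  moreover have "convex D"
    unfolding D_def by (rule convex_hyperbola_region)
  moreover have "C \<inter> D = {}"
  proof -
    have "x \<notin> C" if x: "x \<in> D" for x
    proof -
      obtain s t where "x = c0 + s *\<^sub>R u + t *\<^sub>R w" "0 \<le> t" "1 \<le> s * t"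
        using x unfolding D_def by blast
      moreover from this have "t > 0"
        by (cases "t = 0") auto
      ultimately show ?thesis
        using w(3) by blast
    qed
    then show ?thesis
      by blast
  qed
  moreover have "\<not> strongly_separated C D"
  proof (rule not_strongly_separated_if_asymptotic)
    show "c n \<in> C" for n
      unfolding c_def by (rule u(2)) simp
    show "d n \<in> D" for n
      by (rule d)
    have "(\<lambda>n. inverse (real (Suc n)) *\<^sub>R w) \<longlonglongrightarrow> 0 *\<^sub>R w"
      by (intro tendsto_intros LIMSEQ_inverse_real_of_nat)
    then show "(\<lambda>n. d n - c n) \<longlonglongrightarrow> 0"
      by (simp add: d_def)
  qed
  ultimately show ?thesis
    using d unfolding strong_separation_property_def by blast
qed

end
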